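(* Let $\mathcal{H}$ be a pseudohemisphere hypergraph on a finite totally ordered vertex set $V$ such that every pair of hyperedges of $\mathcal{H}$ has a common vertex. Then there exists a set of at most four vertices of $V$ that intersects every hyperedge of $\mathcal{H}$.
   Context: A hypergraph $\mathcal{F}$ on a totally ordered finite vertex set $V$ (a family of subsets of $V$) is ABA-free if there are no two hyperedges $A,B\in\mathcal{F}$ and vertices $x<y<z$ with $x,z\in A\setminus B$ and $y\in B\setminus A$. For $F\subseteq V$ write $\bar F=V\setminus F$, and $\Delta$ denotes symmetric difference. A hypergraph $\mathcal{H}$ on $V$ is a pseudohemisphere hypergraph if there exist a set $X\subseteq V$ and an ABA-free hypergraph $\mathcal{F}$ on $V$ such that every hyperedge of $\mathcal{H}$ belongs to $\{F\Delta X,\ \bar F\Delta X : F\in\mathcal{F}\}$. *)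

theory Defs
  imports Main
begin

definition hypergraph_on :: "'a set \<Rightarrow> 'a set set \<Rightarrow> bool" where
  "hypergraph_on V \<F> \<longleftrightarrow> \<F> \<subseteq> Pow V"

definition aba_free :: "'a::linorder set \<Rightarrow> 'a set set \<Rightarrow> bool" where
  "aba_free V \<F> \<longleftrightarrow> hypergraph_on V \<F> \<and>
     \<not> (\<exists>A\<in>\<F>. \<exists>B\<in>\<F>. \<exists>x\<in>V. \<exists>y\<in>V. \<exists>z\<in>V. x < y \<and> y < z \<and>
          x \<in> A - B \<and> z \<in> A - B \<and> y \<in> B - A)"

definition pseudohemisphere_hypergraph :: "'a::linorder set \<Rightarrow> 'a set set \<Rightarrow> bool" where
  "pseudohemisphere_hypergraph V \<H> \<longleftrightarrow> hypergraph_on V \<H> \<and>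
     (\<exists>X \<F>. X \<subseteq> V \<and> aba_free V \<F> \<and>
        \<H> \<subseteq> {sym_diff F X | F. F \<in> \<F>} \<union> {sym_diff (V - F) X | F. F \<in> \<F>})"

end

theory Submission
  imports Defs
begin

text \<open>
  Reversing the order between \<open>X\<close> and its complement turns the linear order into a tournament in
  which the out- and in-neighbourhoods of every vertex are acyclic. The sets \<open>U = F \<Delta> X\<close> satisfy the
  ABA condition along transitive triples of this tournament, and no difference of two of them
  contains a cyclic triple; the hyperedges are sets \<open>U\<close> and complements of such sets.

  Suppose no four vertices hit all hyperedges. Two cyclic triples that share two vertices are both
  missed by one hyperedge, so either both or neither lies inside some \<open>U\<close>. Any two cyclic triples are
  connected by such exchanges, so, possibly after complementing, every \<open>U\<close> is acyclic.
  Call \<open>c\<close> unskipped if no \<open>U\<close> missing \<open>c\<close> has members \<open>x \<rightarrow> c \<rightarrow> y\<close> with \<open>x \<rightarrow> y\<close>. Every nonempty \<open>U\<close>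
  contains an unskipped vertex. If there are cyclic triples, take a hyperedge \<open>U\<^sub>0\<close> of the form
  \<open>U\<close> with the fewest unskipped vertices: its first and last unskipped vertex, the unskipped vertex
  just before the former and the one just after the latter hit everything (and a cyclic triple does
  so if all hyperedges are complements). If there are none, two vertices hit the
  hyperedges of the form \<open>U\<close>: the leftmost among their last unskipped vertices and its unskipped
  successor. Dealing with the complements in the same way gives four.
\<close>

section \<open>Locally transitive tournaments\<close>

locale locally_transitive_tournament =
  fixes lt :: "'a \<Rightarrow> 'a \<Rightarrow> bool"  (infix \<open>\<rightarrow>\<close> 50)
  assumes asym: "x \<rightarrow> y \<Longrightarrow> \<not> y \<rightarrow> x"
    and total: "x \<noteq> y \<Longrightarrow> x \<rightarrow> y \<or> y \<rightarrow> x"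
    and no_source: "\<lbrakk>v \<rightarrow> x; v \<rightarrow> y; v \<rightarrow> z; x \<rightarrow> y; y \<rightarrow> z\<rbrakk> \<Longrightarrow> \<not> z \<rightarrow> x"
    and no_sink: "\<lbrakk>x \<rightarrow> v; y \<rightarrow> v; z \<rightarrow> v; x \<rightarrow> y; y \<rightarrow> z\<rbrakk> \<Longrightarrow> \<not> z \<rightarrow> x"
begin

text \<open>In a tournament, forbidding cyclic triples forbids all cycles, so such a
  \<open>W\<close> is linearly ordered by \<open>\<rightarrow>\<close>.\<close>

definition acyclic_on :: "'a set \<Rightarrow> bool" where
  "acyclic_on W \<longleftrightarrow> (\<forall>x\<in>W. \<forall>y\<in>W. \<forall>z\<in>W. \<not> (x \<rightarrow> y \<and> y \<rightarrow> z \<and> z \<rightarrow> x))"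

definition separated :: "'a set set \<Rightarrow> bool" where
  "separated \<U> \<longleftrightarrow> (\<forall>A\<in>\<U>. \<forall>B\<in>\<U>. \<forall>x\<in>A - B. \<forall>y\<in>B - A. \<forall>z\<in>A - B.
     \<not> (x \<rightarrow> y \<and> y \<rightarrow> z \<and> x \<rightarrow> z))"

definition skips :: "'a set \<Rightarrow> 'a \<Rightarrow> bool" where
  "skips A c \<longleftrightarrow> c \<notin> A \<and> (\<exists>x\<in>A. \<exists>y\<in>A. x \<rightarrow> c \<and> c \<rightarrow> y \<and> x \<rightarrow> y)"

text \<open>The unskipped vertices. Nothing confines them to a vertex set, hence the intersections
  with \<open>V\<close> below.\<close>

definition hull :: "'a set set \<Rightarrow> 'a set" where
  "hull \<U> = {c. \<forall>A\<in>\<U>. \<not> skips A c}"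

lemma irrefl: "\<not> x \<rightarrow> x"
  using asym by blast

text \<open>Reversing all arcs swaps \<open>no_source\<close> and \<open>no_sink\<close>, so each
  statement about one end of a set yields the one about the other end.\<close>

lemma dual: "locally_transitive_tournament (\<lambda>x y. y \<rightarrow> x)"
  using asym total no_source no_sink by unfold_locales blast+

lemma acyclic_on_trans:
  assumes "acyclic_on W" "x \<in> W" "y \<in> W" "z \<in> W" "x \<rightarrow> y" "y \<rightarrow> z"
  shows "x \<rightarrow> z"
  using assms total[of x z] asym unfolding acyclic_on_def by blast

lemma acyclic_on_subset: "acyclic_on W \<Longrightarrow> W' \<subseteq> W \<Longrightarrow> acyclic_on W'"
  unfolding acyclic_on_def by blast

lemma separatedD:
  assumes "separated \<U>" "A \<in> \<U>" "B \<in> \<U>" "x \<in> A" "x \<notin> B" "y \<in> B" "y \<notin> A" "z \<in> A" "z \<notin> B"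
    "x \<rightarrow> y" "y \<rightarrow> z" "x \<rightarrow> z"
  shows False
  using assms unfolding separated_def by blast

lemma hullD:
  assumes "c \<in> hull \<U>" "A \<in> \<U>" "c \<notin> A" "x \<in> A" "y \<in> A" "x \<rightarrow> c" "c \<rightarrow> y"
  shows "\<not> x \<rightarrow> y"
  using assms unfolding hull_def skips_def by blast

lemma acyclic_on_least:
  assumes "finite W" "W \<noteq> {}" "acyclic_on W"
  shows "\<exists>m\<in>W. \<forall>x\<in>W. x \<noteq> m \<longrightarrow> m \<rightarrow> x"
  using assms
proof (induction W rule: finite_ne_induct)
  case (singleton x)
  then show ?case by simp
next
  case (insert w W)
  have "acyclic_on W"
    using insert.prems by (rule acyclic_on_subset) blast
  then obtain m where m: "m \<in> W" "\<forall>x\<in>W. x \<noteq> m \<longrightarrow> m \<rightarrow> x"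
    using insert.IH by blast
  show ?case
  proof (cases "m \<rightarrow> w")
    case True
    then show ?thesis using m by blast
  next
    case False
    then have "w \<rightarrow> m"
      using total[of m w] m(1) insert.hyps by blast
    moreover have "w \<rightarrow> x" if "x \<in> W" "x \<noteq> m" for x
      using acyclic_on_trans[OF insert.prems, of w m x] calculation m that by blast
    ultimately show ?thesis by blast
  qed
qed

lemma acyclic_on_dual: "locally_transitive_tournament.acyclic_on (\<lambda>x y. y \<rightarrow> x) W \<longleftrightarrow> acyclic_on W"
  unfolding acyclic_on_def locally_transitive_tournament.acyclic_on_def[OF dual] by blast

lemma separated_dual: "locally_transitive_tournament.separated (\<lambda>x y. y \<rightarrow> x) \<U> \<longleftrightarrow> separated \<U>"
  unfolding separated_def locally_transitive_tournament.separated_def[OF dual] by blast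

lemma hull_dual: "locally_transitive_tournament.hull (\<lambda>x y. y \<rightarrow> x) \<U> = hull \<U>"
  unfolding hull_def locally_transitive_tournament.hull_def[OF dual]
    skips_def locally_transitive_tournament.skips_def[OF dual] by blast

lemma acyclic_on_greatest:
  assumes "finite W" "W \<noteq> {}" "acyclic_on W"
  shows "\<exists>m\<in>W. \<forall>x\<in>W. x \<noteq> m \<longrightarrow> x \<rightarrow> m"
  using locally_transitive_tournament.acyclic_on_least[OF dual assms(1,2)] assms(3)
  unfolding acyclic_on_dual by blast

lemma acyclic_on_out: "acyclic_on {x \<in> V. v \<rightarrow> x}"
  unfolding acyclic_on_def using no_source by blast

section \<open>Existence of unskipped vertices\<close>

lemma hull_meets:
  assumes sep: "separated \<U>" and acy: "\<And>A. A \<in> \<U> \<Longrightarrow> acyclic_on A"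
    and U: "U \<in> \<U>" "finite U" "U \<noteq> {}"
  shows "U \<inter> hull \<U> \<noteq> {}"
proof -
  \<comment> \<open>\<open>L\<close> collects the members of \<open>U\<close> that some
    \<open>A\<close> skips with its left witness outside \<open>U\<close>. The last member of
    \<open>U\<close> is not in \<open>L\<close>: the right witness would be outside \<open>U\<close>
    too, against separation. The first member \<open>h\<close> of \<open>U - L\<close> will turn out
    to be unskipped.\<close>
  define L where "L = {v \<in> U. \<exists>A\<in>\<U>. \<exists>x\<in>A. \<exists>y\<in>A. v \<notin> A \<and> x \<notin> U \<and> x \<rightarrow> v \<and> v \<rightarrow> y \<and> x \<rightarrow> y}"
  obtain m where m: "m \<in> U" "\<forall>x\<in>U. x \<noteq> m \<longrightarrow> x \<rightarrow> m"
    using acyclic_on_greatest[OF U(2,3) acy[OF U(1)]] by blast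
  have "m \<notin> L"
  proof
    assume "m \<in> L"
    then obtain A x y where A: "A \<in> \<U>" "x \<in> A" "y \<in> A" "m \<notin> A" "x \<notin> U"
      "x \<rightarrow> m" "m \<rightarrow> y" "x \<rightarrow> y"
      unfolding L_def by blast
    have "y \<notin> U" using m(2) A asym by metis
    then show False using separatedD[OF sep A(1) U(1), of x m y] A m(1) by blast
  qed
  then have "U - L \<noteq> {}" using m(1) by blast
  moreover have "finite (U - L)" "acyclic_on (U - L)"
    using U acyclic_on_subset[OF acy[OF U(1)]] by auto
  ultimately obtain h where h: "h \<in> U" "h \<notin> L" and hl: "\<forall>x\<in>U - L. x \<noteq> h \<longrightarrow> h \<rightarrow> x"
    using acyclic_on_least[of "U - L"] by blast
  \<comment> \<open>If \<open>B\<close> skips \<open>h\<close>, the last element \<open>h'\<close> of \<open>B\<close> before \<open>h\<close> lies in \<open>L\<close>, and the set \<open>A\<close>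
    that witnesses this violates separation from \<open>B\<close>.\<close>
  have "\<not> skips B h" if B: "B \<in> \<U>" for B
  proof
    assume "skips B h"
    then obtain x0 y0 where B': "h \<notin> B" "x0 \<in> B" "y0 \<in> B" "x0 \<rightarrow> h" "h \<rightarrow> y0" "x0 \<rightarrow> y0"
      unfolding skips_def by blast
    \<comment> \<open>A member of \<open>B\<close> before \<open>h\<close> but outside
      \<open>U\<close> would, with \<open>y0\<close> as right witness, put \<open>h\<close> into
      \<open>L\<close>.\<close>
    have left: "x \<rightarrow> y0 \<and> x \<in> U" if x: "x \<in> B" "x \<rightarrow> h" for x
    proof
      show *: "x \<rightarrow> y0"
      proof (rule ccontr)
        assume "\<not> x \<rightarrow> y0"
        then have y: "y0 \<rightarrow> x" using total x(2) B'(5) asym by metis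
        then have "x0 \<rightarrow> x" using acyclic_on_trans[OF acy[OF B], of x0 y0 x] B' x by blast
        then show False using no_source[of x0 x h y0] B' x y by blast
      qed
      show "x \<in> U" using h * x B B' unfolding L_def by blast
    qed
    let ?W = "{x \<in> B. x \<rightarrow> h}"
    have "?W \<subseteq> U" using left by blast
    then have "finite ?W" "acyclic_on ?W"
      using U(2) finite_subset acyclic_on_subset[OF acy[OF U(1)]] by blast+
    moreover have "?W \<noteq> {}" using B' by blast
    ultimately obtain h' where h': "h' \<in> B" "h' \<rightarrow> h"
      and hm: "\<forall>x\<in>?W. x \<noteq> h' \<longrightarrow> x \<rightarrow> h'"
      using acyclic_on_greatest[of ?W] by blast
    have "h' \<in> U" using left h' by blast
    then have "h' \<in> L" using hl h' asym irrefl by (metis DiffI)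
    then obtain A x y where A: "A \<in> \<U>" "x \<in> A" "y \<in> A" "h' \<notin> A" "x \<notin> U"
      "x \<rightarrow> h'" "h' \<rightarrow> y" "x \<rightarrow> y"
      unfolding L_def by blast
    \<comment> \<open>Otherwise \<open>left\<close> forces \<open>h \<rightarrow> x\<close>, and
      \<open>x\<close>, \<open>h'\<close>, \<open>h\<close> form a cyclic triple among the
      in-neighbours of \<open>y0\<close>.\<close>
    have "x \<notin> B"
    proof
      assume x: "x \<in> B"
      have "h \<rightarrow> x" using left[OF x] A(5) total[of x h] h(1) by blast
      moreover have "h' \<rightarrow> y0" using left h' by blast
      moreover have "x \<rightarrow> y0"
        using acyclic_on_trans[OF acy[OF B], of x h' y0] calculation x h' A B' by blast
      ultimately show False using no_sink[of x y0 h' h] A h' B' by blast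
    qed
    then have "y \<in> B" using separatedD[OF sep A(1) B, of x h' y] A h' by blast
    then have "h \<rightarrow> y" using total[of h y] hm B' A(7) asym irrefl by (metis (mono_tags, lifting) mem_Collect_eq)
    then have "x \<rightarrow> h" using total[of x h] no_sink[of x y h' h] A h' h(1) by blast
    \<comment> \<open>As \<open>x\<close> is outside \<open>U\<close>, a set \<open>A\<close>
      missing \<open>h\<close> would put \<open>h\<close> into \<open>L\<close>.\<close>
    then have "h \<in> A" using h \<open>h \<rightarrow> y\<close> A unfolding L_def by blast
    then show False
      using separatedD[OF sep A(1) B, of x h' h] A h' \<open>x \<notin> B\<close> B' \<open>x \<rightarrow> h\<close> by blast
  qed
  then show ?thesis using h(1) unfolding hull_def by blast
qed

text \<open>The out-neighbourhood of \<open>v\<close> can be added to \<open>\<U>\<close> without destroying the hypotheses of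
  \<open>hull_meets\<close>.\<close>
lemma hull_meets_out:
  assumes sep: "separated \<U>" and acy: "\<And>A. A \<in> \<U> \<Longrightarrow> acyclic_on A"
    and V: "finite V" "\<And>A. A \<in> \<U> \<Longrightarrow> A \<subseteq> V"
    and v: "v \<in> V" "\<not> acyclic_on V"
  shows "\<exists>c \<in> V \<inter> hull \<U>. v \<rightarrow> c"
proof -
  let ?W = "{x \<in> V. v \<rightarrow> x}"
  \<comment> \<open>If nothing followed \<open>v\<close>, a cyclic triple of \<open>V\<close> would
    lie among the in-neighbours of \<open>v\<close>.\<close>
  have "?W \<noteq> {}"
  proof
    assume *: "?W = {}"
    then have in_v: "x = v \<or> x \<rightarrow> v" if "x \<in> V" for x
      using total[of x v] that by blast
    obtain x y z where c: "x \<in> V" "y \<in> V" "z \<in> V" "x \<rightarrow> y" "y \<rightarrow> z" "z \<rightarrow> x"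
      using v(2) unfolding acyclic_on_def by blast
    then have "x \<noteq> v" "y \<noteq> v" "z \<noteq> v" using * by blast+
    then show False using in_v c no_sink[of x v y z] by blast
  qed
  \<comment> \<open>A violation of separation between \<open>?W\<close> and a member of
    \<open>\<U>\<close> closes a cyclic triple through \<open>v\<close>: here \<open>v\<close>,
    \<open>y\<close>, \<open>z\<close> among the out-neighbours of \<open>x\<close>, in
    \<open>in_W\<close> below \<open>v\<close>, \<open>x\<close>, \<open>y\<close> among the
    in-neighbours of \<open>z\<close>.\<close>
  have out_W: False if "A \<in> \<U>" "x \<in> A - ?W" "y \<in> ?W - A" "z \<in> A - ?W" "x \<rightarrow> y" "y \<rightarrow> z" "x \<rightarrow> z" for A x y z
  proof -
    have V': "x \<in> V" "z \<in> V" using that V by blast+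
    then have "z \<rightarrow> v" using that total[of z v] asym by blast
    moreover have "x \<rightarrow> v" using that total[of x v] asym calculation V' by blast
    ultimately show False using that no_source[of x v y z] by blast
  qed
  have in_W: False if "A \<in> \<U>" "x \<in> ?W - A" "y \<in> A - ?W" "z \<in> ?W - A" "x \<rightarrow> y" "y \<rightarrow> z" "x \<rightarrow> z" for A x y z
  proof -
    have "y \<in> V" using that V by blast
    then have "y \<rightarrow> v" using that total[of y v] asym by blast
    then show False using that no_sink[of v z x y] by blast
  qed
  have "separated (insert ?W \<U>)"
    unfolding separated_def
  proof (intro ballI notI, elim conjE)
    fix A B x y z
    assume "A \<in> insert ?W \<U>" "B \<in> insert ?W \<U>"
      and *: "x \<in> A - B" "y \<in> B - A" "z \<in> A - B" "x \<rightarrow> y" "y \<rightarrow> z" "x \<rightarrow> z"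
    then consider "A \<in> \<U>" "B \<in> \<U>" | "A \<in> \<U>" "B = ?W" | "A = ?W" "B \<in> \<U>" | "A = B"
      by blast
    then show False
    proof cases
      case 1
      then show ?thesis using separatedD[OF sep, of A B x y z] * by blast
    next
      case 2
      then show ?thesis using out_W[of A x y z] * by blast
    next
      case 3
      then show ?thesis using in_W[of B x y z] * by blast
    next
      case 4
      then show ?thesis using * by blast
    qed
  qed
  moreover have "acyclic_on A" if "A \<in> insert ?W \<U>" for A
    using acy acyclic_on_out that by blast
  ultimately have "?W \<inter> hull (insert ?W \<U>) \<noteq> {}"
    using hull_meets[of "insert ?W \<U>" ?W] V(1) \<open>?W \<noteq> {}\<close> by fastforce
  \<comment> \<open>Enlarging the family only removes vertices from the hull.\<close>
  moreover have "hull (insert ?W \<U>) \<subseteq> hull \<U>" unfolding hull_def by blast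
  ultimately show ?thesis by blast
qed

section \<open>Neighbouring unskipped vertices and the gaps between them\<close>

lemma next_in_hull:
  assumes "finite V" "\<exists>c \<in> V \<inter> hull \<U>. v \<rightarrow> c"
  shows "\<exists>r \<in> V \<inter> hull \<U>. v \<rightarrow> r \<and> (\<forall>c \<in> V \<inter> hull \<U>. v \<rightarrow> c \<longrightarrow> c \<noteq> r \<longrightarrow> r \<rightarrow> c)"
proof -
  \<comment> \<open>The hull may contain cycles, but its part after \<open>v\<close> is acyclic and
    so has a first vertex.\<close>
  let ?W = "{x \<in> V \<inter> hull \<U>. v \<rightarrow> x}"
  have "finite ?W" "?W \<noteq> {}" using assms by auto
  then obtain r where "r \<in> ?W" "\<forall>x\<in>?W. x \<noteq> r \<longrightarrow> r \<rightarrow> x"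
    using acyclic_on_least[of ?W] acyclic_on_out[of "V \<inter> hull \<U>" v] by blast
  then show ?thesis by blast
qed

lemma prev_in_hull:
  assumes "finite V" "\<exists>c \<in> V \<inter> hull \<U>. c \<rightarrow> v"
  shows "\<exists>p \<in> V \<inter> hull \<U>. p \<rightarrow> v \<and> (\<forall>c \<in> V \<inter> hull \<U>. c \<rightarrow> v \<longrightarrow> c \<noteq> p \<longrightarrow> c \<rightarrow> p)"
  using locally_transitive_tournament.next_in_hull[OF dual assms(1), of \<U> v] assms(2)
  unfolding hull_dual by blast

lemma hull_meets_in:
  assumes sep: "separated \<U>" and acy: "\<And>A. A \<in> \<U> \<Longrightarrow> acyclic_on A"
    and V: "finite V" "\<And>A. A \<in> \<U> \<Longrightarrow> A \<subseteq> V"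
    and v: "v \<in> V" "\<not> acyclic_on V"
  shows "\<exists>c \<in> V \<inter> hull \<U>. c \<rightarrow> v"
  using locally_transitive_tournament.hull_meets_out[OF dual, of \<U> V v] assms
  unfolding hull_dual acyclic_on_dual separated_dual by blast

text \<open>The point \<open>y\<close> lies between \<open>p\<close> and \<open>a\<close>. Both are
  unskipped and missed by \<open>U\<close>, so all of \<open>U\<close> lies there, which
  \<open>gap\<close> denies for \<open>c\<close>. In the application \<open>p\<close> is the
  unskipped predecessor of \<open>a\<close> and \<open>c\<close> is an unskipped vertex of
  \<open>U\<close>.\<close>

lemma hull_gap_before:
  assumes U: "U \<in> \<U>" "acyclic_on U" and U0: "U0 \<in> \<U>"
    and p: "p \<in> hull \<U>" "p \<notin> U" "p \<notin> U0" and a: "a \<in> hull \<U>" "a \<notin> U" "a \<in> U0"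
    and y: "y \<in> U" "y \<in> U0" "y \<rightarrow> a" and c: "c \<in> U"
    and pa: "p \<rightarrow> a" and gap: "c \<rightarrow> a \<Longrightarrow> c \<rightarrow> p"
  shows False
proof -
  have py: "p \<rightarrow> y"
    using hullD[OF p(1) U0 p(3) y(2) a(3) _ pa] y p(2) total[of p y] by blast
  consider "c = y" | "y \<rightarrow> c" | "c \<rightarrow> y" using total[of c y] by blast
  then show False
  proof cases
    case 1
    then show ?thesis using gap y(3) py asym by blast
  next
    case 2
    have "c \<noteq> a" using c a by blast
    then have "c \<rightarrow> a" using hullD[OF a(1) U(1) a(2) y(1) c y(3)] 2 total[of c a] by blast
    then show ?thesis using gap no_sink[of y a c p] 2 y(3) pa py by blast
  next
    case 3
    have "c \<noteq> a" "c \<noteq> p" using c a p by blast+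
    have pc: "p \<rightarrow> c"
      using hullD[OF p(1) U(1) p(2) c y(1) _ py] 3 total[of c p] \<open>c \<noteq> p\<close> by blast
    then have "a \<rightarrow> c" using gap asym total[of a c] \<open>c \<noteq> a\<close> by blast
    then show ?thesis using no_source[of p a c y] pc py pa 3 y(3) by blast
  qed
qed

lemma hull_gap_after:
  assumes U: "U \<in> \<U>" "acyclic_on U" and U0: "U0 \<in> \<U>"
    and r: "r \<in> hull \<U>" "r \<notin> U" "r \<notin> U0" and b: "b \<in> hull \<U>" "b \<notin> U" "b \<in> U0"
    and y: "y \<in> U" "y \<in> U0" "b \<rightarrow> y" and c: "c \<in> U"
    and br: "b \<rightarrow> r" and gap: "b \<rightarrow> c \<Longrightarrow> r \<rightarrow> c"
  shows False
  using locally_transitive_tournament.hull_gap_before[OF dual, of U \<U> U0 r b y c] assms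
  unfolding hull_dual acyclic_on_dual by blast

text \<open>Since \<open>p\<close> and \<open>r\<close> are unskipped, a point \<open>y\<close> of
  \<open>U0\<close> outside \<open>U\<close> would lie between them, and \<open>p\<close>,
  \<open>y\<close>, \<open>r\<close> would violate separation. It serves to make a hyperedge
  \<open>V - U\<close> disjoint from \<open>U0\<close>.\<close>

lemma no_point_outside:
  assumes sep: "separated \<U>" and U: "U \<in> \<U>" "acyclic_on U" and U0: "U0 \<in> \<U>"
    and p: "p \<in> hull \<U>" "p \<in> U" "p \<notin> U0" and r: "r \<in> hull \<U>" "r \<in> U" "r \<notin> U0"
    and a: "a \<in> U" "a \<in> U0" and b: "b \<in> U" "b \<in> U0"
    and o: "p \<rightarrow> a" "a = b \<or> a \<rightarrow> b" "b \<rightarrow> r"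
  shows "U0 \<subseteq> U"
proof
  fix y assume y: "y \<in> U0"
  show "y \<in> U"
  proof (rule ccontr)
    assume yU: "y \<notin> U"
    have ar: "a \<rightarrow> r" and pb: "p \<rightarrow> b"
      using acyclic_on_trans[OF U(2)] a b p r o by blast+
    have pr: "p \<rightarrow> r"
      using acyclic_on_trans[OF U(2), of p a r] a p r o ar by blast
    have neq: "y \<noteq> a" "y \<noteq> b" "y \<noteq> p" "y \<noteq> r" using y yU a b p r by blast+
    have "p \<rightarrow> y"
    proof (rule ccontr)
      assume "\<not> p \<rightarrow> y"
      then have yp: "y \<rightarrow> p" using total neq by blast
      then have ay: "a \<rightarrow> y"
        using hullD[OF p(1) U0 p(3) y a(2) _ o(1)] total neq by blast
      then have "r \<rightarrow> y"
        using no_sink[of y r p a] yp o(1) ar pr total[of y r] neq by blast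
      then have "y \<rightarrow> b"
        using hullD[OF r(1) U0 r(3) b(2) y o(3)] total[of y b] neq by blast
      then show False
        using no_sink[of y b p a] yp ay o pb asym by blast
    qed
    moreover have "y \<rightarrow> r"
    proof (rule ccontr)
      assume "\<not> y \<rightarrow> r"
      then have ry: "r \<rightarrow> y" using total neq by blast
      then have "y \<rightarrow> b"
        using hullD[OF r(1) U0 r(3) b(2) y o(3)] total[of y b] neq by blast
      then show False
        using no_source[of p b r y] ry o(3) pb pr calculation by blast
    qed
    ultimately show False
      using separatedD[OF sep U(1) U0 p(2,3) y yU r(2,3)] pr by blast
  qed
qed

section \<open>Four vertices in a tournament with cycles\<close>

lemma hitting_set_cyclic:
  assumes V: "finite V" "\<And>A. A \<in> \<U> \<Longrightarrow> A \<subseteq> V" "\<not> acyclic_on V"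
    and sep: "separated \<U>" and acy: "\<And>A. A \<in> \<U> \<Longrightarrow> acyclic_on A"
    and H: "\<H> \<subseteq> \<U> \<union> (-) V ` \<U>"
    and int: "\<And>A B. A \<in> \<H> \<Longrightarrow> B \<in> \<H> \<Longrightarrow> A \<inter> B \<noteq> {}"
  shows "\<exists>S. S \<subseteq> V \<and> card S \<le> 4 \<and> (\<forall>A\<in>\<H>. A \<inter> S \<noteq> {})"
proof (cases "\<H> \<inter> \<U> = {}")
  case True
  obtain x y z where c: "x \<in> V" "y \<in> V" "z \<in> V" "x \<rightarrow> y" "y \<rightarrow> z" "z \<rightarrow> x"
    using V(3) unfolding acyclic_on_def by blast
  have "A \<inter> {x, y, z} \<noteq> {}" if A: "A \<in> \<H>" for A
  proof
    assume *: "A \<inter> {x, y, z} = {}"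
    obtain U where "U \<in> \<U>" "A = V - U" using A True H by blast
    then show False using c acy[of U] * unfolding acyclic_on_def by blast
  qed
  moreover have "card {x, y, z} \<le> 4"
    by (simp add: card_insert_if)
  moreover have "{x, y, z} \<subseteq> V" using c by blast
  ultimately show ?thesis by blast
next
  case False
  let ?C = "hull \<U>"
  obtain U0 where U0: "U0 \<in> \<H>" "U0 \<in> \<U>"
    and min: "\<And>U. U \<in> \<H> \<Longrightarrow> U \<in> \<U> \<Longrightarrow> card (U0 \<inter> ?C) \<le> card (U \<inter> ?C)"
    using False ex_has_least_nat[of "\<lambda>U. U \<in> \<H> \<inter> \<U>" _ "\<lambda>U. card (U \<inter> ?C)"] by blast
  have fin: "finite U" if "U \<in> \<U>" for U using V that finite_subset by blast
  have meets: "U \<inter> ?C \<noteq> {}" if "U \<in> \<H>" "U \<in> \<U>" for U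
    using hull_meets[OF sep acy] fin int[OF that(1) that(1)] that(2) by blast
  have W: "finite (U0 \<inter> ?C)" "acyclic_on (U0 \<inter> ?C)"
    using fin[OF U0(2)] acyclic_on_subset[OF acy[OF U0(2)]] by blast+
  obtain a where a: "a \<in> U0" "a \<in> ?C" and al: "\<forall>x \<in> U0 \<inter> ?C. x \<noteq> a \<longrightarrow> a \<rightarrow> x"
    using acyclic_on_least[OF W(1) meets[OF U0] W(2)] by blast
  obtain b where b: "b \<in> U0" "b \<in> ?C" and bg: "\<forall>x \<in> U0 \<inter> ?C. x \<noteq> b \<longrightarrow> x \<rightarrow> b"
    using acyclic_on_greatest[OF W(1) meets[OF U0] W(2)] by blast
  have ab: "a = b \<or> a \<rightarrow> b" using al b by (metis IntI)
  have "a \<in> V" "b \<in> V" using a b V(2) U0(2) by blast+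
  obtain p where p: "p \<in> V" "p \<in> ?C" "p \<rightarrow> a"
    and pg: "\<forall>c \<in> V \<inter> ?C. c \<rightarrow> a \<longrightarrow> c \<noteq> p \<longrightarrow> c \<rightarrow> p"
    using prev_in_hull[OF V(1) hull_meets_in[OF sep acy V(1,2) \<open>a \<in> V\<close> V(3)]] by blast
  obtain r where r: "r \<in> V" "r \<in> ?C" "b \<rightarrow> r"
    and rl: "\<forall>c \<in> V \<inter> ?C. b \<rightarrow> c \<longrightarrow> c \<noteq> r \<longrightarrow> r \<rightarrow> c"
    using next_in_hull[OF V(1) hull_meets_out[OF sep acy V(1,2) \<open>b \<in> V\<close> V(3)]] by blast
  have pU0: "p \<notin> U0" using al p asym irrefl by (metis IntI)
  have rU0: "r \<notin> U0" using bg r asym irrefl by (metis IntI)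
  have up: False if U: "U \<in> \<H>" "U \<in> \<U>" and avoid: "p \<notin> U" "a \<notin> U" "b \<notin> U" "r \<notin> U" for U
  proof -
    obtain y where y: "y \<in> U" "y \<in> U0" using int[OF U(1) U0(1)] by blast
    obtain c where c: "c \<in> U" "c \<in> ?C" using meets[OF U] by blast
    have cV: "c \<in> V" using c V(2) U(2) by blast
    have "c \<noteq> p" "c \<noteq> r" "y \<noteq> a" "y \<noteq> b" using avoid c y by blast+
    \<comment> \<open>No unskipped vertex lies between \<open>p\<close> and \<open>a\<close> or
      between \<open>b\<close> and \<open>r\<close>, so \<open>c\<close> supplies the gap
      hypotheses, and the common point \<open>y\<close> is confined to the stretch from
      \<open>a\<close> to \<open>b\<close>.\<close>
    have "\<not> y \<rightarrow> a"
      using hull_gap_before[OF U(2) acy[OF U(2)] U0(2) p(2) avoid(1) pU0 a(2) avoid(2) a(1) y _ c(1) p(3)]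
        pg cV c(2) \<open>c \<noteq> p\<close> by blast
    then have ay: "a \<rightarrow> y" using total \<open>y \<noteq> a\<close> by blast
    have "\<not> b \<rightarrow> y"
      using hull_gap_after[OF U(2) acy[OF U(2)] U0(2) r(2) avoid(4) rU0 b(2) avoid(3) b(1) y _ c(1) r(3)]
        rl cV c(2) \<open>c \<noteq> r\<close> by blast
    then have yb: "y \<rightarrow> b" using total \<open>y \<noteq> b\<close> by blast
    have ab': "a \<rightarrow> b" using ab ay yb asym by blast
    \<comment> \<open>\<open>a\<close> and \<open>b\<close> are unskipped and missed by
      \<open>U\<close>, so \<open>U\<close> cannot extend past either of them.\<close>
    have between: "a \<rightarrow> u \<and> u \<rightarrow> b" if u: "u \<in> U" for u
    proof (cases "u = y")
      case True
      then show ?thesis using ay yb by blast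
    next
      case False
      have neq: "u \<noteq> a" "u \<noteq> b" using avoid u by blast+
      consider "u \<rightarrow> y" | "y \<rightarrow> u" using total[of u y] False by blast
      then show ?thesis
      proof cases
        case 1
        then have "a \<rightarrow> u"
          using hullD[OF a(2) U(2) avoid(2) u y(1) _ ay] total[of a u] neq by blast
        moreover have "u \<rightarrow> b"
          using no_source[of a u y b] 1 yb ay ab' calculation total[of u b] neq by blast
        ultimately show ?thesis by blast
      next
        case 2
        then have "u \<rightarrow> b"
          using hullD[OF b(2) U(2) avoid(3) y(1) u yb] total[of b u] neq by blast
        moreover have "a \<rightarrow> u"
          using no_sink[of a b y u] 2 yb ay ab' calculation total[of a u] neq by blast
        ultimately show ?thesis by blast
      qed
    qed
    \<comment> \<open>An unskipped vertex between \<open>a\<close> and \<open>b\<close> belongs to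
      \<open>U0\<close>, which would otherwise skip it. The vertex \<open>a\<close> makes the
      inclusion strict, against the minimal choice of \<open>U0\<close>.\<close>
    have "U \<inter> ?C \<subseteq> U0 \<inter> ?C"
      using between hullD[OF _ U0(2) _ a(1) b(1)] ab' by blast
    then have "U \<inter> ?C \<subset> U0 \<inter> ?C" using a avoid by blast
    then show False using min[OF U] psubset_card_mono[OF W(1)] by (meson leD)
  qed
  \<comment> \<open>A complement \<open>V - U\<close> missing all four vertices means that
    \<open>U\<close> contains them, hence contains \<open>U0\<close>.\<close>
  have down: False if U: "V - U \<in> \<H>" "U \<in> \<U>" and mem: "p \<in> U" "a \<in> U" "b \<in> U" "r \<in> U" for U
    using no_point_outside[OF sep U(2) acy[OF U(2)] U0(2) p(2) mem(1) pU0 r(2) mem(4) rU0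
        mem(2) a(1) mem(3) b(1) p(3) ab r(3)] int[OF U0(1) U(1)] by blast
  have mem: "{p, a, b, r} \<subseteq> V" using p r \<open>a \<in> V\<close> \<open>b \<in> V\<close> by blast
  have "A \<inter> {p, a, b, r} \<noteq> {}" if A: "A \<in> \<H>" for A
  proof
    assume *: "A \<inter> {p, a, b, r} = {}"
    from A H consider "A \<in> \<U>" | U where "U \<in> \<U>" "A = V - U" by blast
    then show False
    proof cases
      case 1
      then show ?thesis using up[OF A] * by blast
    next
      case 2
      then show ?thesis using down[of U] A * mem by blast
    qed
  qed
  moreover have "card {p, a, b, r} \<le> 4"
    by (simp add: card_insert_if)
  ultimately show ?thesis using mem by blast
qed

section \<open>Two vertices for each kind of hyperedge in a transitive tournament\<close>

lemma hitting_pair: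
  assumes V: "finite V" "\<And>A. A \<in> \<U> \<Longrightarrow> A \<subseteq> V" "acyclic_on V"
    and sep: "separated \<U>" and G: "\<G> \<subseteq> \<U>"
    and int: "\<And>A B. A \<in> \<G> \<Longrightarrow> B \<in> \<G> \<Longrightarrow> A \<inter> B \<noteq> {}"
  shows "\<exists>S. S \<subseteq> V \<and> card S \<le> 2 \<and> (\<forall>A\<in>\<G>. A \<inter> S \<noteq> {})"
proof (cases "\<G> = {}")
  case True
  then show ?thesis by (intro exI[of _ "{}"]) simp
next
  case False
  let ?C = "hull \<U>"
  let ?top = "\<lambda>U m. m \<in> U \<inter> ?C \<and> (\<forall>x \<in> U \<inter> ?C. x \<noteq> m \<longrightarrow> x \<rightarrow> m)"
  let ?W = "{m \<in> V. \<exists>U\<in>\<G>. ?top U m}"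
  have acy: "acyclic_on A" if "A \<in> \<U>" for A
    using acyclic_on_subset[OF V(3) V(2)[OF that]] .
  have ex_top: "\<exists>m. ?top U m" if U: "U \<in> \<G>" for U
  proof -
    have U': "U \<in> \<U>" using U G by blast
    have "finite U" using V U' finite_subset by blast
    moreover have "U \<inter> ?C \<noteq> {}"
      using hull_meets[OF sep acy U'] calculation int[OF U U] by blast
    ultimately show ?thesis
      using acyclic_on_greatest[of "U \<inter> ?C"] acyclic_on_subset[OF acy[OF U']] by blast
  qed
  have "?W \<noteq> {}"
  proof -
    obtain U where U: "U \<in> \<G>" using False by blast
    then obtain m where "?top U m" using ex_top by blast
    moreover have "m \<in> V" using calculation U V(2) G by blast
    ultimately show ?thesis using U by blast
  qed
  moreover have "finite ?W" using V(1) by simp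
  moreover have "acyclic_on ?W" by (rule acyclic_on_subset[OF V(3)]) blast
  ultimately obtain b U1 where b: "b \<in> V" "U1 \<in> \<G>" "?top U1 b"
    and bl: "\<forall>m\<in>?W. m \<noteq> b \<longrightarrow> b \<rightarrow> m"
    using acyclic_on_least[of ?W] by blast
  show ?thesis
  proof (cases "\<exists>c \<in> V \<inter> ?C. b \<rightarrow> c")
    case False
    \<comment> \<open>Nothing unskipped follows \<open>b\<close>, so the last unskipped vertex of
      every \<open>U\<close> is \<open>b\<close> itself.\<close>
    have "b \<in> U" if U: "U \<in> \<G>" for U
    proof -
      obtain m where m: "?top U m" using ex_top[OF U] by blast
      then have "m \<in> V" using U V(2) G by blast
      then have "m = b" using bl m U False by auto
      then show ?thesis using m by blast
    qed
    then show ?thesis using b by (intro exI[of _ "{b}"]) auto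
  next
    case True
    obtain r where r: "r \<in> V" "r \<in> ?C" "b \<rightarrow> r"
      and rl: "\<forall>c \<in> V \<inter> ?C. b \<rightarrow> c \<longrightarrow> c \<noteq> r \<longrightarrow> r \<rightarrow> c"
      using next_in_hull[OF V(1) True] by blast
    have rU1: "r \<notin> U1" using b(3) r asym irrefl by (metis IntI)
    have "b \<in> U \<or> r \<in> U" if U: "U \<in> \<G>" for U
    proof (rule ccontr)
      assume *: "\<not> (b \<in> U \<or> r \<in> U)"
      have U': "U \<in> \<U>" "U1 \<in> \<U>" using U b G by blast+
      obtain m where m: "?top U m" using ex_top[OF U] by blast
      then have mV: "m \<in> V" using U V(2) G by blast
      have neq: "m \<noteq> b" "m \<noteq> r" using m * by blast+
      then have "b \<rightarrow> m" using bl m U mV by auto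
      then have rm: "r \<rightarrow> m" using rl m mV neq by blast
      \<comment> \<open>The common point \<open>y\<close> makes some set skip \<open>r\<close>:
        \<open>U\<close> does so between \<open>y\<close> and \<open>m\<close> if \<open>y\<close>
        precedes \<open>r\<close>, and \<open>U1\<close> between \<open>b\<close> and
        \<open>y\<close> if \<open>y\<close> follows it.\<close>
      obtain y where y: "y \<in> U" "y \<in> U1" using int[OF U b(2)] by blast
      then have yV: "y \<in> V" using V(2) U' by blast
      have "y \<noteq> r" using y * by blast
      then consider "y \<rightarrow> r" | "r \<rightarrow> y" using total by blast
      then show False
      proof cases
        case 1
        then have "y \<rightarrow> m" using acyclic_on_trans[OF V(3), of y r m] rm mV yV r by blast
        then show ?thesis using hullD[OF r(2) U'(1) _ y(1) _ 1 rm] * m by blast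
      next
        case 2
        then have "b \<rightarrow> y" using acyclic_on_trans[OF V(3), of b r y] yV r b by blast
        then show ?thesis using hullD[OF r(2) U'(2) rU1 _ y(2) r(3) 2] b by blast
      qed
    qed
    moreover have "card {b, r} \<le> 2" by (simp add: card_insert_if)
    moreover have "{b, r} \<subseteq> V" using b(1) r(1) by simp
    ultimately show ?thesis by (intro exI[of _ "{b, r}"]) simp
  qed
qed

text \<open>Complementing swaps the differences \<open>A - B\<close> and \<open>B - A\<close>, and
  separation ranges over both orders of a pair.\<close>

lemma separated_complements:
  assumes "separated \<U>" "\<And>A. A \<in> \<U> \<Longrightarrow> A \<subseteq> V"
  shows "separated ((-) V ` \<U>)"
  unfolding separated_def
proof (intro ballI notI, elim imageE conjE)
  fix A B A' B' x y z
  assume AB: "A = V - A'" "B = V - B'" "A' \<in> \<U>" "B' \<in> \<U>"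
    and *: "x \<in> A - B" "y \<in> B - A" "z \<in> A - B" "x \<rightarrow> y" "y \<rightarrow> z" "x \<rightarrow> z"
  have "A - B = B' - A'" "B - A = A' - B'" using AB assms(2) by auto
  then show False
    using separatedD[OF assms(1), of B' A' x y z] AB(3,4) * by simp
qed

lemma hitting_set_acyclic:
  assumes V: "finite V" "\<And>A. A \<in> \<U> \<Longrightarrow> A \<subseteq> V" "acyclic_on V"
    and sep: "separated \<U>"
    and H: "\<H> \<subseteq> \<U> \<union> (-) V ` \<U>"
    and int: "\<And>A B. A \<in> \<H> \<Longrightarrow> B \<in> \<H> \<Longrightarrow> A \<inter> B \<noteq> {}"
  shows "\<exists>S. S \<subseteq> V \<and> card S \<le> 4 \<and> (\<forall>A\<in>\<H>. A \<inter> S \<noteq> {})"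
proof -
  obtain S where S: "S \<subseteq> V" "card S \<le> 2" "\<forall>A\<in>\<H> \<inter> \<U>. A \<inter> S \<noteq> {}"
    using hitting_pair[OF V sep, of "\<H> \<inter> \<U>"] int by blast
  obtain T where T: "T \<subseteq> V" "card T \<le> 2" "\<forall>A\<in>\<H> \<inter> (-) V ` \<U>. A \<inter> T \<noteq> {}"
    using hitting_pair[OF V(1) _ V(3) separated_complements[OF sep V(2)], of "\<H> \<inter> (-) V ` \<U>"] int
    by blast
  have "card (S \<union> T) \<le> 4" using card_Un_le[of S T] S T by linarith
  moreover have "\<forall>A\<in>\<H>. A \<inter> (S \<union> T) \<noteq> {}"
  proof
    fix A assume A: "A \<in> \<H>"
    then have "A \<inter> S \<noteq> {} \<or> A \<inter> T \<noteq> {}" using S(3) T(3) H by (metis IntI UnE subsetD)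
    then show "A \<inter> (S \<union> T) \<noteq> {}" by blast
  qed
  ultimately show ?thesis using S(1) T(1) by (intro exI[of _ "S \<union> T"] conjI Un_least)
qed

section \<open>Exchanges between cyclic triples\<close>

lemma cyclic_triple_through:
  assumes step: "\<And>x y z w. \<lbrakk>{x, y, z, w} \<subseteq> V; x \<rightarrow> y; y \<rightarrow> z; z \<rightarrow> x; y \<rightarrow> w; w \<rightarrow> x; P {x, y, z}\<rbrakk>
      \<Longrightarrow> P {x, y, w}"
    and xyz: "{x, y, z} \<subseteq> V" "x \<rightarrow> y" "y \<rightarrow> z" "z \<rightarrow> x" "P {x, y, z}"
    and v: "v \<in> V"
  shows "\<exists>p\<in>V. \<exists>q\<in>V. v \<rightarrow> p \<and> p \<rightarrow> q \<and> q \<rightarrow> v \<and> P {v, p, q}"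
proof -
  have rot: "{y, z, x} = {x, y, z}" "{z, x, y} = {x, y, z}" by auto
  \<comment> \<open>A vertex outside the triple neither dominates it nor is dominated by it, so it
    can replace the vertex opposite some arc.\<close>
  consider "v \<in> {x, y, z}" | "y \<rightarrow> v" "v \<rightarrow> x" | "z \<rightarrow> v" "v \<rightarrow> y" | "x \<rightarrow> v" "v \<rightarrow> z"
    using no_source[of v x y z] no_sink[of x v y z] xyz(2-4) total[of v] by blast
  then show ?thesis
  proof cases
    case 1
    then have "v = x \<or> v = y \<or> v = z" by blast
    then show ?thesis
    proof (elim disjE)
      assume "v = y"
      then show ?thesis using xyz rot(1) by (intro bexI[of _ z] bexI[of _ x]) simp_all
    next
      assume "v = z"
      then show ?thesis using xyz rot(2) by (intro bexI[of _ x] bexI[of _ y]) simp_all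
    qed (use xyz in blast)
  next
    case 2
    have "P {x, y, v}" using step[of x y z v] xyz v 2 by simp
    moreover have "{x, y, v} = {v, x, y}" by auto
    ultimately show ?thesis using 2 xyz by auto
  next
    case 3
    have "P {y, z, v}" using step[of y z x v] xyz v 3 rot by simp
    moreover have "{y, z, v} = {v, y, z}" by auto
    ultimately show ?thesis using 3 xyz by auto
  next
    case 4
    have "P {z, x, v}" using step[of z x y v] xyz v 4 rot by simp
    moreover have "{z, x, v} = {v, z, x}" by auto
    ultimately show ?thesis using 4 xyz by auto
  qed
qed

text \<open>First a triple \<open>a\<close>, \<open>p\<close>, \<open>q\<close> through
  \<open>a\<close> is reached; then \<open>p\<close> and \<open>q\<close> are replaced by
  \<open>b\<close> and \<open>c\<close> one at a time, in whichever order keeps the intermediate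
  triple cyclic.\<close>

lemma cyclic_triple_exchange:
  assumes step: "\<And>x y z w. \<lbrakk>{x, y, z, w} \<subseteq> V; x \<rightarrow> y; y \<rightarrow> z; z \<rightarrow> x; y \<rightarrow> w; w \<rightarrow> x; P {x, y, z}\<rbrakk>
      \<Longrightarrow> P {x, y, w}"
    and xyz: "{x, y, z} \<subseteq> V" "x \<rightarrow> y" "y \<rightarrow> z" "z \<rightarrow> x" "P {x, y, z}"
    and abc: "{a, b, c} \<subseteq> V" "a \<rightarrow> b" "b \<rightarrow> c" "c \<rightarrow> a"
  shows "P {a, b, c}"
proof -
  have "a \<in> V" using abc(1) by blast
  have "\<exists>p\<in>V. \<exists>q\<in>V. a \<rightarrow> p \<and> p \<rightarrow> q \<and> q \<rightarrow> a \<and> P {a, p, q}"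
    by (rule cyclic_triple_through[where P = P, OF _ xyz \<open>a \<in> V\<close>]) (rule step)
  then obtain p q where pq: "p \<in> V" "q \<in> V" "a \<rightarrow> p" "p \<rightarrow> q" "q \<rightarrow> a" "P {a, p, q}"
    by (elim bexE conjE)
  have ca: "P {a, b, c}" if "u \<in> V" "b \<rightarrow> u" "u \<rightarrow> a" "P {a, b, u}" for u
    using step[of a b u c] abc that by simp
  have ca': "P {a, b, c}" if "u \<in> V" "u \<rightarrow> c" "a \<rightarrow> u" "P {c, a, u}" for u
  proof -
    have "P {c, a, b}" using step[of c a u b] abc that by simp
    then show ?thesis by (simp add: insert_commute)
  qed
  have rot: "{p, q, a} = {a, p, q}" "{q, a, p} = {a, p, q}" "{q, a, b} = {a, b, q}"
    "{a, p, c} = {c, a, p}" by auto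
  consider "b = p" | "b = q" | "c = p" | "c = q" | "b \<rightarrow> q" "b \<noteq> p" | "p \<rightarrow> c" "c \<noteq> q"
    | "q \<rightarrow> b" "b \<noteq> p" "c \<rightarrow> p" "c \<noteq> q"
    using total[of b q] total[of c p] by blast
  then show ?thesis
  proof cases
    case 1
    then show ?thesis using ca[of q] pq by simp
  next
    case 2
    then show ?thesis using abc pq asym by blast
  next
    case 3
    then show ?thesis using abc pq asym by blast
  next
    case 4
    then show ?thesis using ca'[of p] pq by (simp add: insert_commute)
  next
    case 5
    have "P {q, a, b}" using step[of q a p b] pq abc 5 rot by simp
    then show ?thesis using ca[of q] pq 5 rot by simp
  next
    case 6
    have "P {a, p, c}" using step[of a p q c] pq abc 6 rot by simp
    then show ?thesis using ca'[of p] pq 6 rot by simp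
  next
    \<comment> \<open>Only here are both orders blocked; then \<open>b \<rightarrow> p\<close> puts
      the cyclic triple \<open>a\<close>, \<open>b\<close>, \<open>c\<close> among the in-neighbours
      of \<open>p\<close>.\<close>
    case 7
    have "b \<rightarrow> p" using no_sink[of a b p q] total[of b p] 7 pq abc by blast
    then show ?thesis using no_sink[of a p b c] abc pq 7 by blast
  qed
qed

section \<open>Reduction to acyclic members\<close>

lemma hitting_set:
  assumes V: "finite V" "\<And>A. A \<in> \<U> \<Longrightarrow> A \<subseteq> V"
    and sep: "separated \<U>" and acy: "\<And>A B. A \<in> \<U> \<Longrightarrow> B \<in> \<U> \<Longrightarrow> acyclic_on (A - B)"
    and H: "\<H> \<subseteq> \<U> \<union> (-) V ` \<U>"
    and int: "\<And>A B. A \<in> \<H> \<Longrightarrow> B \<in> \<H> \<Longrightarrow> A \<inter> B \<noteq> {}"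
  shows "\<exists>S. S \<subseteq> V \<and> card S \<le> 4 \<and> (\<forall>A\<in>\<H>. A \<inter> S \<noteq> {})"
proof (rule ccontr)
  assume none: "\<not> ?thesis"
  have cyc: "\<not> acyclic_on V"
    using hitting_set_acyclic[OF V _ sep H int] none by blast
  let ?P = "\<lambda>T. \<exists>U\<in>\<U>. T \<subseteq> U"
  have no_cycle: False if "A \<in> \<U>" "B \<in> \<U>" "{x, y, z} \<subseteq> A - B" "x \<rightarrow> y" "y \<rightarrow> z" "z \<rightarrow> x" for A B x y z
    using acy[OF that(1,2)] that(3-) unfolding acyclic_on_def by blast
  have step: "?P {x, y, w}"
    if xyz: "{x, y, z, w} \<subseteq> V" "x \<rightarrow> y" "y \<rightarrow> z" "z \<rightarrow> x" "y \<rightarrow> w" "w \<rightarrow> x" "?P {x, y, z}" for x y z w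
  proof -
    have "card {x, y, z, w} \<le> 4" by (simp add: card_insert_if)
    \<comment> \<open>If this \<open>A\<close> were in \<open>\<U>\<close>, the triple would lie in
      a difference \<open>U - A\<close>. So \<open>A\<close> is a complement \<open>V - U\<close>,
      and that \<open>U\<close> contains \<open>w\<close> as well.\<close>
    then obtain A where A: "A \<in> \<H>" "A \<inter> {x, y, z, w} = {}" using none xyz(1) by blast
    from A(1) H consider "A \<in> \<U>" | U where "U \<in> \<U>" "A = V - U" by blast
    then show ?thesis
    proof cases
      case 1
      obtain U where "U \<in> \<U>" "{x, y, z} \<subseteq> U" using xyz(7) by blast
      then have False using no_cycle[of U A x y z] 1 A(2) xyz(2-4) by blast
      then show ?thesis ..
    next
      case 2
      then show ?thesis using A(2) xyz(1) by blast
    qed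
  qed
  show False
  proof (cases "\<exists>x y z. {x, y, z} \<subseteq> V \<and> x \<rightarrow> y \<and> y \<rightarrow> z \<and> z \<rightarrow> x \<and> ?P {x, y, z}")
    case True
    then obtain x y z where xyz: "{x, y, z} \<subseteq> V" "x \<rightarrow> y" "y \<rightarrow> z" "z \<rightarrow> x" "?P {x, y, z}"
      by (elim exE conjE)
    \<comment> \<open>All cyclic triples now lie in members of \<open>\<U>\<close>. One inside a
      complement \<open>V - B\<close> would thus lie in a difference \<open>U - B\<close>, so the
      complements are acyclic and can take the place of \<open>\<U>\<close>.\<close>
    have all: "?P {a, b, c}" if "{a, b, c} \<subseteq> V" "a \<rightarrow> b" "b \<rightarrow> c" "c \<rightarrow> a" for a b c
      by (rule cyclic_triple_exchange[where P = ?P, OF _ xyz that]) (rule step)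
    have "acyclic_on A" if A: "A \<in> (-) V ` \<U>" for A
      unfolding acyclic_on_def
    proof (intro ballI notI, elim conjE)
      fix a b c assume abc: "a \<in> A" "b \<in> A" "c \<in> A" "a \<rightarrow> b" "b \<rightarrow> c" "c \<rightarrow> a"
      obtain B where B: "B \<in> \<U>" "A = V - B" using A by blast
      have "{a, b, c} \<subseteq> V" using abc(1-3) B(2) by blast
      then obtain U where "U \<in> \<U>" "{a, b, c} \<subseteq> U" using all abc(4-6) by blast
      then show False using no_cycle[of U B a b c] B abc by blast
    qed
    moreover have "\<H> \<subseteq> (-) V ` \<U> \<union> (-) V ` (-) V ` \<U>"
    proof
      fix A assume "A \<in> \<H>"
      then have "A \<in> \<U> \<or> A \<in> (-) V ` \<U>" using H by blast
      moreover have "A = V - (V - A)" if "A \<in> \<U>" using V(2)[OF that] by blast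
      ultimately show "A \<in> (-) V ` \<U> \<union> (-) V ` (-) V ` \<U>" by blast
    qed
    ultimately show False
      using hitting_set_cyclic[OF V(1) _ cyc separated_complements[OF sep V(2)] _ _ int] none by blast
  next
    case False
    have "acyclic_on A" if A: "A \<in> \<U>" for A
      unfolding acyclic_on_def
    proof (intro ballI notI, elim conjE)
      fix a b c assume abc: "a \<in> A" "b \<in> A" "c \<in> A" "a \<rightarrow> b" "b \<rightarrow> c" "c \<rightarrow> a"
      then have "{a, b, c} \<subseteq> V" "{a, b, c} \<subseteq> A" using V(2)[OF A] by blast+
      then show False using False A abc by blast
    qed
    then show False using hitting_set_cyclic[OF V cyc sep _ H int] none by blast
  qed
qed

end

section \<open>The tournament of a reoriented linear order\<close>

definition reoriented :: "'a::linorder set \<Rightarrow> 'a \<Rightarrow> 'a \<Rightarrow> bool" where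
  "reoriented X x y \<longleftrightarrow> (if x \<in> X \<longleftrightarrow> y \<in> X then x < y else y < x)"

text \<open>Place the vertices in order on an open half circle and move those in \<open>X\<close> to
  their antipodes: the out-neighbours of a vertex are those on the half circle following it, the
  in-neighbours those on the one preceding it.\<close>

lemma locally_transitive_tournament_reoriented:
  "locally_transitive_tournament (reoriented X)"
proof
  show "\<not> reoriented X y x" if "reoriented X x y" for x y
    using that unfolding reoriented_def by (auto split: if_splits)
  show "reoriented X x y \<or> reoriented X y x" if "x \<noteq> y" for x y
    using that unfolding reoriented_def by auto
  show "\<not> reoriented X z x"
    if "reoriented X v x" "reoriented X v y" "reoriented X v z" "reoriented X x y" "reoriented X y z"
    for v x y z
    using that unfolding reoriented_def by (auto split: if_splits)
  show "\<not> reoriented X z x"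
    if "reoriented X x v" "reoriented X y v" "reoriented X z v" "reoriented X x y" "reoriented X y z"
    for v x y z
    using that unfolding reoriented_def by (auto split: if_splits)
qed

text \<open>\<open>D\<close> and \<open>E\<close> stand for \<open>A - B\<close> and
  \<open>B - A\<close>; symmetric difference with \<open>X\<close> exchanges them on
  \<open>X\<close>. For each pattern of membership in \<open>X\<close>, the arcs are either
  contradictory or give an alternation of \<open>D\<close> and \<open>E\<close> in the original
  order.\<close>

lemma no_alternation_transitive:
  assumes alt: "\<And>x y z. \<lbrakk>x < y; y < z; x \<in> D; y \<in> E; z \<in> D\<rbrakk> \<Longrightarrow> False"
    "\<And>x y z. \<lbrakk>x < y; y < z; x \<in> E; y \<in> D; z \<in> E\<rbrakk> \<Longrightarrow> False"
    and x: "x \<notin> X \<and> x \<in> D \<or> x \<in> X \<and> x \<in> E"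
    and y: "y \<notin> X \<and> y \<in> E \<or> y \<in> X \<and> y \<in> D"
    and z: "z \<notin> X \<and> z \<in> D \<or> z \<in> X \<and> z \<in> E"
    and ord: "reoriented X x y" "reoriented X y z" "reoriented X x z"
  shows False
  using x y z ord unfolding reoriented_def
  by (elim disjE conjE; simp; (blast dest: alt less_trans | fastforce dest: alt less_trans))

text \<open>A cyclic triple must be split by \<open>X\<close>, and the vertex alone on its side is
  the middle one in the original order, so \<open>D\<close> and \<open>E\<close> alternate.\<close>

lemma no_alternation_cyclic:
  assumes alt: "\<And>x y z. \<lbrakk>x < y; y < z; x \<in> D; y \<in> E; z \<in> D\<rbrakk> \<Longrightarrow> False"
    "\<And>x y z. \<lbrakk>x < y; y < z; x \<in> E; y \<in> D; z \<in> E\<rbrakk> \<Longrightarrow> False"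
    and x: "x \<notin> X \<and> x \<in> D \<or> x \<in> X \<and> x \<in> E"
    and y: "y \<notin> X \<and> y \<in> D \<or> y \<in> X \<and> y \<in> E"
    and z: "z \<notin> X \<and> z \<in> D \<or> z \<in> X \<and> z \<in> E"
    and ord: "reoriented X x y" "reoriented X y z" "reoriented X z x"
  shows False
  using x y z ord unfolding reoriented_def
  by (elim disjE conjE; simp; (blast dest: alt less_trans | fastforce dest: alt less_trans))

lemma aba_freeD:
  assumes "aba_free V \<F>" "A \<in> \<F>" "B \<in> \<F>" "x < y" "y < z"
    "x \<in> A" "x \<notin> B" "y \<in> B" "y \<notin> A" "z \<in> A" "z \<notin> B"
  shows False
proof -
  have "A \<subseteq> V" "B \<subseteq> V" using assms(1-3) unfolding aba_free_def hypergraph_on_def by auto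
  then have "x \<in> V" "y \<in> V" "z \<in> V" using assms(6-11) by auto
  then show False using assms unfolding aba_free_def by blast
qed

theorem mainTheorem8:
  fixes V :: "'a::linorder set" and \<H> :: "'a set set"
  assumes "finite V"
    and "pseudohemisphere_hypergraph V \<H>"
    and "\<forall>A\<in>\<H>. \<forall>B\<in>\<H>. A \<inter> B \<noteq> {}"
  shows "\<exists>S. S \<subseteq> V \<and> card S \<le> 4 \<and> (\<forall>A\<in>\<H>. A \<inter> S \<noteq> {})"
proof -
  obtain X \<F> where X: "X \<subseteq> V" and F: "aba_free V \<F>"
    and H: "\<H> \<subseteq> {sym_diff F X | F. F \<in> \<F>} \<union> {sym_diff (V - F) X | F. F \<in> \<F>}"
    using assms(2) unfolding pseudohemisphere_hypergraph_def by blast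
  interpret locally_transitive_tournament "reoriented X"
    by (rule locally_transitive_tournament_reoriented)
  let ?U = "(\<lambda>F. sym_diff F X) ` \<F>"
  have FV: "A \<subseteq> V" if "A \<in> \<F>" for A
    using F that unfolding aba_free_def hypergraph_on_def by blast
  have sub: "A \<subseteq> V" if "A \<in> ?U" for A
    using that FV X by blast
  have alt: False
    if "A \<in> \<F>" "B \<in> \<F>" "x < y" "y < z" "x \<in> A - B" "y \<in> B - A" "z \<in> A - B" for A B x y z
    using aba_freeD[OF F that(1-4)] that(5-7) by blast
  have sep: "separated ?U"
    unfolding separated_def
  proof (intro ballI notI, elim imageE conjE)
    fix A' B' A B x y z
    assume *: "A' = sym_diff A X" "B' = sym_diff B X" "A \<in> \<F>" "B \<in> \<F>"
      "x \<in> A' - B'" "y \<in> B' - A'" "z \<in> A' - B'"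
      "reoriented X x y" "reoriented X y z" "reoriented X x z"
    have x: "x \<notin> X \<and> x \<in> A - B \<or> x \<in> X \<and> x \<in> B - A" using *(1,2,5) by blast
    have y: "y \<notin> X \<and> y \<in> B - A \<or> y \<in> X \<and> y \<in> A - B" using *(1,2,6) by blast
    have z: "z \<notin> X \<and> z \<in> A - B \<or> z \<in> X \<and> z \<in> B - A" using *(1,2,7) by blast
    show False
      by (rule no_alternation_transitive[OF alt[OF *(3,4)] alt[OF *(4,3)] x y z *(8-10)])
  qed
  have acy: "acyclic_on (A' - B')" if AB': "A' \<in> ?U" "B' \<in> ?U" for A' B'
    unfolding acyclic_on_def
  proof (intro ballI notI, elim conjE)
    fix x y z
    assume *: "x \<in> A' - B'" "y \<in> A' - B'" "z \<in> A' - B'"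
      "reoriented X x y" "reoriented X y z" "reoriented X z x"
    obtain A B where AB: "A' = sym_diff A X" "B' = sym_diff B X" "A \<in> \<F>" "B \<in> \<F>"
      using AB' by (elim imageE)
    have x: "x \<notin> X \<and> x \<in> A - B \<or> x \<in> X \<and> x \<in> B - A" using *(1) AB(1,2) by blast
    have y: "y \<notin> X \<and> y \<in> A - B \<or> y \<in> X \<and> y \<in> B - A" using *(2) AB(1,2) by blast
    have z: "z \<notin> X \<and> z \<in> A - B \<or> z \<in> X \<and> z \<in> B - A" using *(3) AB(1,2) by blast
    show False
      by (rule no_alternation_cyclic[OF alt[OF AB(3,4)] alt[OF AB(4,3)] x y z *(4-6)])
  qed
  \<comment> \<open>Complementation in \<open>V\<close> commutes with symmetric difference by
    \<open>X\<close>, because \<open>X \<subseteq> V\<close>.\<close>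
  have HU: "\<H> \<subseteq> ?U \<union> (-) V ` ?U"
  proof
    fix A assume "A \<in> \<H>"
    then consider F where "F \<in> \<F>" "A = sym_diff F X" | F where "F \<in> \<F>" "A = sym_diff (V - F) X"
      using H by blast
    then show "A \<in> ?U \<union> (-) V ` ?U"
    proof cases
      case 1
      then show ?thesis by blast
    next
      case 2
      then have "A = V - sym_diff F X" using X FV by blast
      then show ?thesis using 2 by blast
    qed
  qed
  show ?thesis
    by (rule hitting_set[OF assms(1) sub sep acy HU]) (assumption+, rule assms(3)[rule_format])
qed

end
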